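(* Let $X$ be a nonempty list of $n$-dimensional binary vectors, i.e., $\varnothing\neq X\subseteq\{0,1\}^n$. Then $$\mathrm{xc}(\mathrm{forb}([0,1]^n,X))\le \mathcal{O}(n|X|),$$ i.e., there is an absolute constant $C$ such that $\mathrm{xc}(\mathrm{forb}([0,1]^n,X))\le C\,n|X|$ for all $n\geq 1$ and all such $X$.
   Context: For a polytope $P$ with vertex set $\mathrm{vert}(P)$ and $X\subseteq\mathrm{vert}(P)$, $\mathrm{forb}(P,X):=\mathrm{conv}(\mathrm{vert}(P)\setminus X)$, where $\mathrm{conv}$ denotes convex hull; in particular $\mathrm{forb}([0,1]^n,X)=\mathrm{conv}(\{0,1\}^n\setminus X)$. An extended formulation of a polytope $P$ is a description by linear equations and inequalities of a polyhedron whose image under a linear map is $P$. The extension complexity $\mathrm{xc}(P)$ is the minimum number of inequalities in any extended formulation of $P$ (equations are not counted). *)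

theory Defs
  imports "HOL-Analysis.Analysis" "HOL-Analysis.Finite_Function_Topology"
begin

(* R^n is rendered as the subspace of finitely supported real sequences with support in {..<n}.
   This keeps the dimension n a term, so that constants can be independent of n, while convex
   hulls, extreme points and linear maps remain the library's. *)
definition Rn :: "nat \<Rightarrow> (nat \<Rightarrow>\<^sub>0 real) set" where
  "Rn n = {x. Poly_Mapping.keys x \<subseteq> {..<n}}"

definition cube :: "nat \<Rightarrow> (nat \<Rightarrow>\<^sub>0 real) set" where
  "cube n = {x \<in> Rn n. \<forall>i<n. 0 \<le> Poly_Mapping.lookup x i \<and> Poly_Mapping.lookup x i \<le> 1}"

definition binary_vectors :: "nat \<Rightarrow> (nat \<Rightarrow>\<^sub>0 real) set" where
  "binary_vectors n = {x \<in> Rn n. \<forall>i<n. Poly_Mapping.lookup x i = 0 \<or> Poly_Mapping.lookup x i = 1}"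

definition vert :: "'a::real_vector set \<Rightarrow> 'a set" where
  "vert P = {v. v extreme_point_of P}"

definition forb :: "'a::real_vector set \<Rightarrow> 'a set \<Rightarrow> 'a set" where
  "forb P X = convex hull (vert P - X)"

(* The polyhedron in R^d given by the k inequalities A y \<le> b and the m equations E y = f;
   only entries with row index below k (resp. m) and column index below d matter. *)
definition polyhedron_of ::
  "nat \<Rightarrow> nat \<Rightarrow> (nat \<Rightarrow> nat \<Rightarrow> real) \<Rightarrow> (nat \<Rightarrow> real) \<Rightarrow>
   nat \<Rightarrow> (nat \<Rightarrow> nat \<Rightarrow> real) \<Rightarrow> (nat \<Rightarrow> real) \<Rightarrow> (nat \<Rightarrow>\<^sub>0 real) set" where
  "polyhedron_of d k A b m E f = {y \<in> Rn d.
     (\<forall>i<k. (\<Sum>j<d. A i j * Poly_Mapping.lookup y j) \<le> b i) \<and>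
     (\<forall>i<m. (\<Sum>j<d. E i j * Poly_Mapping.lookup y j) = f i)}"

(* Every linear map on the subspace R^d extends to a linear map T on the whole space, so
   requiring T to be linear everywhere is no restriction. *)
definition has_extended_formulation :: "'a::real_vector set \<Rightarrow> nat \<Rightarrow> bool" where
  "has_extended_formulation P k \<longleftrightarrow>
     (\<exists>d A b m E f. \<exists>T :: (nat \<Rightarrow>\<^sub>0 real) \<Rightarrow> 'a.
        linear T \<and> T ` polyhedron_of d k A b m E f = P)"

(* Only meant for polytopes P, for which the minimum exists. *)
definition xc :: "'a::real_vector set \<Rightarrow> nat" where
  "xc P = (LEAST k. has_extended_formulation P k)"

end

theory Submission
  imports Defs
begin

text \<open>Read a binary vector coordinate by coordinate. It avoids \<open>X\<close> iff it leaves the prefix tree of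
  \<open>X\<close> at some point, and from then on all continuations are allowed, so at every level a single
  additional state suffices to record that the tree has been left. The vectors avoiding \<open>X\<close> are thus
  the source-sink paths of a layered acyclic network with at most \<open>4 n |X|\<close> arcs. Every unit flow is
  a convex combination of such paths, so nonnegative flows, with one inequality per arc and flow
  conservation as equations, project onto the convex hull of these vectors.\<close>

section \<open>Flow formulations\<close>

lemma lookup_scaleR: "Poly_Mapping.lookup (a *\<^sub>R x) i = a *\<^sub>R Poly_Mapping.lookup x i"
  by (simp add: scaleR_poly_mapping_def)

text \<open>The only inequalities are the sign constraints, so the size is the number of variables
  however many equations \<open>K\<close> contributes. Enumerations of \<open>J\<close> and
  \<open>K\<close> turn the indices into column and row numbers.\<close>

lemma has_extended_formulation_nonneg_system:
  fixes g :: "'j \<Rightarrow> 'a::real_vector" and c :: "'k \<Rightarrow> 'j \<Rightarrow> real"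
  assumes "finite J" "finite K"
  shows "has_extended_formulation
    {\<Sum>j\<in>J. y j *\<^sub>R g j |y. (\<forall>j\<in>J. 0 \<le> y j) \<and> (\<forall>k\<in>K. (\<Sum>j\<in>J. c k j * y j) = f k)} (card J)"
    (is "has_extended_formulation ?P _")
proof -
  define d where "d = card J"
  define m where "m = card K"
  obtain h where h: "bij_betw h {..<d} J"
    using ex_bij_betw_nat_finite[OF assms(1)] by (auto simp: d_def lessThan_atLeast0)
  obtain r where r: "bij_betw r {..<m} K"
    using ex_bij_betw_nat_finite[OF assms(2)] by (auto simp: m_def lessThan_atLeast0)
  define T :: "(nat \<Rightarrow>\<^sub>0 real) \<Rightarrow> 'a"
    where "T = (\<lambda>z. \<Sum>i<d. Poly_Mapping.lookup z i *\<^sub>R g (h i))"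
  \<comment> \<open>Minus the identity: the rows of \<open>A z \<le> 0\<close> are the sign
    constraints on \<open>z\<close>.\<close>
  define A :: "nat \<Rightarrow> nat \<Rightarrow> real" where "A = (\<lambda>i j. if i = j then - 1 else 0)"
  define Q where "Q = polyhedron_of d d A (\<lambda>_. 0) m (\<lambda>i j. c (r i) (h j)) (\<lambda>i. f (r i))"
  have lin: "linear T"
    unfolding T_def
    by (intro linearI)
      (simp_all add: lookup_scaleR lookup_add scaleR_add_left sum.distrib scaleR_sum_right)
  have A_sum: "(\<Sum>j<d. A i j * z j) = - z i" if "i < d" for i z
  proof -
    have "(\<Sum>j<d. A i j * z j) = (\<Sum>j<d. if i = j then - z j else 0)"
      by (intro sum.cong) (auto simp: A_def)
    then show ?thesis using that by simp
  qed
  have sum_h: "(\<Sum>i<d. F (h i)) = (\<Sum>j\<in>J. F j)" for F :: "'j \<Rightarrow> 'b::comm_monoid_add"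
    using sum.reindex_bij_betw[OF h] .
  have "T ` Q = ?P"
  proof (intro equalityI subsetI)
    fix x assume "x \<in> T ` Q"
    then obtain z where z: "z \<in> Q" "x = T z" by blast
    define y where "y j = Poly_Mapping.lookup z (the_inv_into {..<d} h j)" for j
    have yh: "y (h i) = Poly_Mapping.lookup z i" if "i < d" for i
      using that h by (simp add: y_def the_inv_into_f_f bij_betw_def)
    have "x = (\<Sum>i<d. y (h i) *\<^sub>R g (h i))"
      by (simp add: z T_def yh)
    then have "x = (\<Sum>j\<in>J. y j *\<^sub>R g j)" by (simp add: sum_h[of "\<lambda>j. y j *\<^sub>R g j"])
    moreover have "0 \<le> y j" if "j \<in> J" for j
    proof -
      from that h obtain i where i: "i < d" "j = h i" by (auto simp: bij_betw_def)
      then show ?thesis using z(1) by (simp add: Q_def polyhedron_of_def A_sum yh)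
    qed
    moreover have "(\<Sum>j\<in>J. c k j * y j) = f k" if "k \<in> K" for k
    proof -
      from that r obtain i where i: "i < m" "k = r i" by (auto simp: bij_betw_def)
      have "(\<Sum>j\<in>J. c k j * y j) = (\<Sum>j<d. c k (h j) * y (h j))"
        by (simp add: sum_h[of "\<lambda>j. c k j * y j"])
      also have "\<dots> = f k" using z(1) i by (simp add: Q_def polyhedron_of_def yh)
      finally show ?thesis .
    qed
    ultimately show "x \<in> ?P" by blast
  next
    fix x assume "x \<in> ?P"
    then obtain y where y: "x = (\<Sum>j\<in>J. y j *\<^sub>R g j)" "\<And>j. j \<in> J \<Longrightarrow> 0 \<le> y j"
      "\<And>k. k \<in> K \<Longrightarrow> (\<Sum>j\<in>J. c k j * y j) = f k" by blast
    define z where "z = (\<Sum>i<d. Poly_Mapping.single i (y (h i)))"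
    have lz: "Poly_Mapping.lookup z i = (if i < d then y (h i) else 0)" for i
      by (auto simp: z_def lookup_sum lookup_single when_def)
    have "z \<in> Rn d" by (auto simp: Rn_def in_keys_iff lz split: if_splits)
    moreover have "h i \<in> J" if "i < d" for i using h that by (auto simp: bij_betw_def)
    moreover have "r i \<in> K" if "i < m" for i using r that by (auto simp: bij_betw_def)
    ultimately have "z \<in> Q"
      using y(2,3) by (auto simp: Q_def polyhedron_of_def A_sum lz sum_h[of "\<lambda>j. c _ j * y j"])
    moreover have "T z = x" by (simp add: T_def lz y(1) sum_h[of "\<lambda>j. y j *\<^sub>R g j"])
    ultimately show "x \<in> T ` Q" by blast
  qed
  then show ?thesis
    using lin unfolding has_extended_formulation_def Q_def d_def by blast
qed

text \<open>The constraints on \<open>y\<close> are preserved by convex combinations and the point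
  depends linearly on \<open>y\<close>, so the witnesses can be combined with the same
  weights.\<close>

lemma convex_nonneg_system:
  fixes g :: "'j \<Rightarrow> 'a::real_vector" and c :: "'k \<Rightarrow> 'j \<Rightarrow> real"
  shows "convex {\<Sum>j\<in>J. y j *\<^sub>R g j |y. (\<forall>j\<in>J. 0 \<le> y j) \<and> (\<forall>k\<in>K. (\<Sum>j\<in>J. c k j * y j) = f k)}"
    (is "convex ?P")
proof (rule convexI)
  fix a b :: 'a and u v :: real
  assume ab: "a \<in> ?P" "b \<in> ?P" and uv: "0 \<le> u" "0 \<le> v" "u + v = 1"
  from ab(1) obtain y where y: "a = (\<Sum>j\<in>J. y j *\<^sub>R g j)" "\<And>j. j \<in> J \<Longrightarrow> 0 \<le> y j"
    "\<And>k. k \<in> K \<Longrightarrow> (\<Sum>j\<in>J. c k j * y j) = f k" by blast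
  from ab(2) obtain z where z: "b = (\<Sum>j\<in>J. z j *\<^sub>R g j)" "\<And>j. j \<in> J \<Longrightarrow> 0 \<le> z j"
    "\<And>k. k \<in> K \<Longrightarrow> (\<Sum>j\<in>J. c k j * z j) = f k" by blast
  define w where "w j = u * y j + v * z j" for j
  have "u *\<^sub>R a + v *\<^sub>R b = (\<Sum>j\<in>J. w j *\<^sub>R g j)"
    by (simp add: y z w_def scaleR_add_left sum.distrib scaleR_sum_right)
  moreover have "(\<Sum>j\<in>J. c k j * w j) = f k" if "k \<in> K" for k
  proof -
    have "(\<Sum>j\<in>J. c k j * w j) = u * (\<Sum>j\<in>J. c k j * y j) + v * (\<Sum>j\<in>J. c k j * z j)"
      by (simp add: w_def distrib_left sum.distrib sum_distrib_left mult.left_commute)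
    also have "\<dots> = f k" using that uv(3) by (simp add: y z flip: distrib_right)
    finally show ?thesis .
  qed
  moreover have "0 \<le> w j" if "j \<in> J" for j using that uv by (simp add: y z w_def)
  ultimately show "u *\<^sub>R a + v *\<^sub>R b \<in> ?P" by blast
qed

section \<open>Binary words and the vertices of the cube\<close>

definition word_vector :: "bool list \<Rightarrow> (nat \<Rightarrow>\<^sub>0 real)" where
  "word_vector w = (\<Sum>i<length w. if w ! i then Poly_Mapping.single i 1 else 0)"

lemma lookup_word_vector:
  "Poly_Mapping.lookup (word_vector w) i = of_bool (i < length w \<and> w ! i)"
proof -
  have "Poly_Mapping.lookup (word_vector w) i
      = (\<Sum>k<length w. if i = k then of_bool (w ! k) else 0)"
    unfolding word_vector_def lookup_sum
    by (intro sum.cong) (auto simp: lookup_single when_def)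
  then show ?thesis by auto
qed

lemma word_vector_snoc:
  "word_vector (w @ [b]) = word_vector w + (if b then Poly_Mapping.single (length w) 1 else 0)"
proof -
  have "(\<Sum>i<length w. if (w @ [b]) ! i then Poly_Mapping.single i 1 else 0) = word_vector w"
    unfolding word_vector_def by (intro sum.cong) (auto simp: nth_append)
  then show ?thesis unfolding word_vector_def[of "w @ [b]"] by simp
qed

lemma inj_on_word_vector: "inj_on word_vector {w. length w = n}"
proof (rule inj_onI)
  fix v w assume vw: "v \<in> {w. length w = n}" "w \<in> {w. length w = n}" "word_vector v = word_vector w"
  show "v = w"
  proof (rule nth_equalityI)
    fix i assume "i < length v"
    moreover have "Poly_Mapping.lookup (word_vector v) i = Poly_Mapping.lookup (word_vector w) i"
      by (simp add: vw(3))
    ultimately show "v ! i = w ! i" using vw(1,2) by (simp add: lookup_word_vector of_bool_def split: if_splits)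
  qed (use vw in simp)
qed

lemma word_vector_image: "word_vector ` {w. length w = n} = binary_vectors n"
proof (intro equalityI subsetI)
  fix x assume "x \<in> word_vector ` {w. length w = n}"
  then show "x \<in> binary_vectors n"
    by (auto simp: binary_vectors_def Rn_def in_keys_iff lookup_word_vector)
next
  fix x assume x: "x \<in> binary_vectors n"
  define w where "w = map (\<lambda>i. Poly_Mapping.lookup x i = 1) [0..<n]"
  have "Poly_Mapping.lookup x i = 0" if "\<not> i < n" for i
    using x that by (auto simp: binary_vectors_def Rn_def in_keys_iff)
  then have "x = word_vector w"
    using x by (intro poly_mapping_eqI) (auto simp: w_def lookup_word_vector binary_vectors_def)
  then show "x \<in> word_vector ` {w. length w = n}" by (simp add: w_def)
qed

text \<open>A coordinate strictly between 0 and 1 can be moved in both directions. Conversely, 0 and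
  1 are extreme in the unit interval, so a segment of the cube with a binary inner point is constant
  in every coordinate.\<close>

lemma vert_cube: "vert (cube n) = binary_vectors n"
proof (intro equalityI subsetI)
  fix v assume "v \<in> vert (cube n)"
  then have v: "v \<in> cube n" and ext: "\<And>a b. a \<in> cube n \<Longrightarrow> b \<in> cube n \<Longrightarrow> v \<notin> open_segment a b"
    by (auto simp: vert_def extreme_point_of_def)
  have "Poly_Mapping.lookup v i = 0 \<or> Poly_Mapping.lookup v i = 1" if i: "i < n" for i
  proof (rule ccontr)
    let ?t = "Poly_Mapping.lookup v i"
    assume "\<not> ?thesis"
    with v i have t: "0 < ?t" "?t < 1" by (auto simp: cube_def less_le)
    \<comment> \<open>The largest shift that keeps coordinate \<open>i\<close> in the unit interval
      in both directions.\<close>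
    define e where "e = min ?t (1 - ?t)"
    have e: "0 < e" "e \<le> ?t" "e \<le> 1 - ?t" using t by (auto simp: e_def)
    let ?a = "v + Poly_Mapping.single i e" and ?b = "v - Poly_Mapping.single i e"
    have "?a \<in> cube n" "?b \<in> cube n"
      using v i e
      by (auto simp: cube_def Rn_def in_keys_iff lookup_add lookup_minus lookup_single when_def subset_iff)
    moreover have "v \<in> open_segment ?a ?b"
    proof -
      have "Poly_Mapping.lookup ?a i \<noteq> Poly_Mapping.lookup ?b i"
        using e by (simp add: lookup_add lookup_minus)
      then have "?a \<noteq> ?b" by metis
      moreover have "v = (1 - 1/2) *\<^sub>R ?a + (1/2) *\<^sub>R ?b"
        by (simp add: algebra_simps flip: scaleR_left_distrib)
      ultimately show ?thesis unfolding in_segment by (intro conjI exI[of _ "1/2"]) auto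
    qed
    ultimately show False using ext by blast
  qed
  with v show "v \<in> binary_vectors n" by (auto simp: cube_def binary_vectors_def)
next
  fix v assume v: "v \<in> binary_vectors n"
  have "v \<notin> open_segment a b" if ab: "a \<in> cube n" "b \<in> cube n" for a b
  proof
    assume "v \<in> open_segment a b"
    then obtain u where u: "0 < u" "u < 1" "v = (1 - u) *\<^sub>R a + u *\<^sub>R b" and ne: "a \<noteq> b"
      by (auto simp: in_segment)
    have "Poly_Mapping.lookup a i = Poly_Mapping.lookup b i" for i
    proof (cases "i < n")
      case True
      let ?x = "Poly_Mapping.lookup a i" and ?y = "Poly_Mapping.lookup b i"
      have xy: "0 \<le> ?x" "?x \<le> 1" "0 \<le> ?y" "?y \<le> 1" using ab True by (auto simp: cube_def)
      have eq: "Poly_Mapping.lookup v i = (1 - u) * ?x + u * ?y"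
        using u by (simp add: lookup_scaleR lookup_add)
      from v True consider "Poly_Mapping.lookup v i = 0" | "Poly_Mapping.lookup v i = 1"
        by (auto simp: binary_vectors_def)
      then show ?thesis
      proof cases
        case 1
        have "(1 - u) * ?x = 0 \<and> u * ?y = 0"
          using eq 1 xy u by (subst add_nonneg_eq_0_iff[symmetric]) auto
        then show ?thesis using u by simp
      next
        case 2
        \<comment> \<open>Reflecting the coordinate at 1/2 gives again two nonnegative terms with
          sum 0.\<close>
        have "(1 - u) * (1 - ?x) + u * (1 - ?y) = 0"
          using eq 2 by (simp add: algebra_simps)
        then have "(1 - u) * (1 - ?x) = 0 \<and> u * (1 - ?y) = 0"
          using xy u by (subst add_nonneg_eq_0_iff[symmetric]) auto
        then show ?thesis using u by simp
      qed
    next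
      case False
      then have "i \<notin> Poly_Mapping.keys a" "i \<notin> Poly_Mapping.keys b"
        using ab by (auto simp: cube_def Rn_def)
      then show ?thesis by (simp add: in_keys_iff)
    qed
    then show False using ne by (simp add: poly_mapping_eq_iff fun_eq_iff)
  qed
  moreover have "v \<in> cube n" using v by (force simp: cube_def binary_vectors_def)
  ultimately show "v \<in> vert (cube n)" by (auto simp: vert_def extreme_point_of_def)
qed

section \<open>Branching programs\<close>

text \<open>\<open>q w\<close> is the state reached by reading \<open>w\<close>. The level function
  keeps states at different depths distinct, so the network is layered and acyclic.\<close>

locale branching_program =
  fixes n :: nat and q :: "bool list \<Rightarrow> 's" and lev :: "'s \<Rightarrow> nat"
    and \<delta> :: "'s \<Rightarrow> bool \<Rightarrow> 's" and acc :: "'s set"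
  assumes n_pos: "0 < n"
    and lev_q: "lev (q w) = length w"
    and q_snoc: "length w < n \<Longrightarrow> q (w @ [b]) = \<delta> (q w) b"
begin

abbreviation words :: "nat \<Rightarrow> bool list set" where
  "words i \<equiv> {w. length w = i}"

text \<open>An arc is named by its tail and the letter read, its head being
  \<open>\<delta> s b\<close>. Thus two arcs with the same ends but different letters stay distinct,
  and each state before the last level has exactly two outgoing arcs.\<close>

definition arcs :: "('s \<times> bool) set" where
  "arcs = q ` {w. length w < n} \<times> UNIV"

definition level_arcs :: "nat \<Rightarrow> ('s \<times> bool) set" where
  "level_arcs i = q ` words i \<times> UNIV"

definition label :: "'s \<times> bool \<Rightarrow> (nat \<Rightarrow>\<^sub>0 real)" where
  "label = (\<lambda>(s, b). if b then Poly_Mapping.single (lev s) 1 else 0)"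

text \<open>The equation of a word shorter than \<open>n\<close> is flow conservation at its state (with unit supply
  at the source); the one of a word of length \<open>n\<close> forbids flow into a rejecting state.\<close>

definition coeff :: "bool list \<Rightarrow> 's \<times> bool \<Rightarrow> real" where
  "coeff w = (\<lambda>(s, b). if length w < n then of_bool (s = q w) - of_bool (\<delta> s b = q w)
     else of_bool (q w \<notin> acc \<and> \<delta> s b = q w))"

text \<open>Equations are indexed by words rather than states. Words that reach the same state have
  equal length and so give the same equation; such repetitions cost nothing because equations are
  not counted.\<close>

definition flow :: "('s \<times> bool \<Rightarrow> real) \<Rightarrow> bool" where
  "flow y \<longleftrightarrow> (\<forall>j\<in>arcs. 0 \<le> y j) \<and>
     (\<forall>w\<in>{w. length w \<le> n}. (\<Sum>j\<in>arcs. coeff w j * y j) = of_bool (w = []))"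

lemma finite_words: "finite (words i)"
  using finite_lists_length_eq[of "UNIV :: bool set" i] by simp

lemma finite_words_le: "finite {w :: bool list. length w \<le> i}"
  using finite_lists_length_le[of "UNIV :: bool set" i] by simp

lemma finite_words_less: "finite {w :: bool list. length w < i}"
  by (rule finite_subset[OF _ finite_words_le[of i]]) auto

lemma finite_arcs: "finite arcs"
  by (simp add: arcs_def finite_words_less)

lemma sum_words_Suc:
  "(\<Sum>w\<in>words (Suc i). F w) = (\<Sum>w\<in>words i. \<Sum>b\<in>UNIV. F (w @ [b]))"
  for F :: "bool list \<Rightarrow> 'b::comm_monoid_add"
proof -
  have "bij_betw (\<lambda>(w, b). w @ [b]) (words i \<times> UNIV) (words (Suc i))"
  proof (rule bij_betwI[where g = "\<lambda>w. (butlast w, last w)"])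
    show "(\<lambda>(w, b). w @ [b]) (butlast w, last w) = w" if "w \<in> words (Suc i)" for w
      using that by (cases w rule: rev_cases) simp_all
  qed auto
  from sum.reindex_bij_betw[OF this, of F] show ?thesis
    by (simp add: sum.cartesian_product case_prod_unfold)
qed

lemma lev_\<delta>: "s \<in> q ` {w. length w < n} \<Longrightarrow> lev (\<delta> s b) = Suc (lev s)"
  by (auto simp: lev_q simp flip: q_snoc)

lemma arcs_of_level: "i < n \<Longrightarrow> {j \<in> arcs. lev (fst j) = i} = level_arcs i"
  by (auto simp: arcs_def level_arcs_def lev_q)

lemma sum_arcs_levels: "(\<Sum>j\<in>arcs. F j) = (\<Sum>i<n. \<Sum>j\<in>level_arcs i. F j)"
  for F :: "'s \<times> bool \<Rightarrow> 'b::comm_monoid_add"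
proof -
  have "(\<Sum>j\<in>arcs. F j) = (\<Sum>i<n. \<Sum>j\<in>{j \<in> arcs. lev (fst j) = i}. F j)"
    by (rule sum.group[symmetric]) (use finite_arcs in \<open>auto simp: arcs_def lev_q\<close>)
  then show ?thesis by (simp add: arcs_of_level)
qed

lemma sum_arcs_level:
  fixes F :: "'s \<times> bool \<Rightarrow> real"
  assumes "i < n" "\<And>j. j \<in> arcs \<Longrightarrow> lev (fst j) \<noteq> i \<Longrightarrow> F j = 0"
  shows "(\<Sum>j\<in>arcs. F j) = (\<Sum>j\<in>level_arcs i. F j)"
  unfolding arcs_of_level[OF assms(1), symmetric]
  by (rule sum.mono_neutral_right) (use assms finite_arcs in auto)

section \<open>Accepted words as unit flows\<close>

definition path_flow :: "bool list \<Rightarrow> 's \<times> bool \<Rightarrow> real" where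
  "path_flow v j = (\<Sum>i<n. of_bool (j = (q (take i v), v ! i)))"

text \<open>Since \<open>path_flow\<close> is a sum over positions, the two summations can be
  exchanged, and each position then picks out its own arc.\<close>

lemma sum_path_flow:
  fixes F :: "'s \<times> bool \<Rightarrow> 'b::real_vector"
  assumes "length v = n"
  shows "(\<Sum>j\<in>arcs. path_flow v j *\<^sub>R F j) = (\<Sum>i<n. F (q (take i v), v ! i))"
proof -
  have "(\<Sum>j\<in>arcs. path_flow v j *\<^sub>R F j)
      = (\<Sum>i<n. \<Sum>j\<in>arcs. of_bool (j = (q (take i v), v ! i)) *\<^sub>R F j)"
    unfolding path_flow_def scaleR_sum_left by (rule sum.swap)
  also have "\<dots> = (\<Sum>i<n. F (q (take i v), v ! i))"
  proof (rule sum.cong[OF refl])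
    fix i assume i: "i \<in> {..<n}"
    let ?a = "(q (take i v), v ! i)"
    have a: "?a \<in> arcs" using i assms by (auto simp: arcs_def)
    have "(\<Sum>j\<in>arcs. of_bool (j = ?a) *\<^sub>R F j) = (\<Sum>j\<in>arcs. if j = ?a then F j else 0)"
      by (rule sum.cong) auto
    also have "\<dots> = F ?a" using a finite_arcs by simp
    finally show "(\<Sum>j\<in>arcs. of_bool (j = ?a) *\<^sub>R F j) = F ?a" .
  qed
  finally show ?thesis .
qed

lemma sum_of_bool_at:
  assumes "\<And>i. i < n \<Longrightarrow> P i \<Longrightarrow> i = k" "k < n"
  shows "(\<Sum>i<n. of_bool (P i) :: real) = of_bool (P k)"
proof -
  have "(\<Sum>i<n. of_bool (P i) :: real) = (\<Sum>i<n. if i = k then of_bool (P k) else 0)"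
  proof (rule sum.cong[OF refl])
    show "of_bool (P i) = (if i = k then of_bool (P k) else 0 :: real)" if "i \<in> {..<n}" for i
      using assms(1)[of i] that by auto
  qed
  then show ?thesis using assms(2) by simp
qed

text \<open>By the levels, the path can be at \<open>q w\<close> only at time
  \<open>length w\<close>. It leaves an inner state exactly as often as it enters it, and it ends in
  the accepting state \<open>q v\<close>.\<close>

lemma flow_path_flow:
  assumes v: "length v = n" "q v \<in> acc"
  shows "flow (path_flow v)"
proof -
  have step: "\<delta> (q (take i v)) (v ! i) = q (take (Suc i) v)" if "i < n" for i
    using q_snoc[of "take i v" "v ! i"] that v by (simp add: take_Suc_conv_app_nth)
  have len: "length w = i" if "q (take i v) = q w" "i \<le> n" for w i
    using that v lev_q[of w] lev_q[of "take i v"] by simp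
  have "(\<Sum>j\<in>arcs. coeff w j * path_flow v j) = of_bool (w = [])" if w: "length w \<le> n" for w
  proof -
    have "(\<Sum>j\<in>arcs. coeff w j * path_flow v j) = (\<Sum>i<n. coeff w (q (take i v), v ! i))"
      using sum_path_flow[OF v(1), of "coeff w"] by (simp add: mult.commute)
    also have "\<dots> = of_bool (w = [])"
    proof (cases "length w < n")
      case True
      have out: "(\<Sum>i<n. of_bool (q (take i v) = q w) :: real) = of_bool (q (take (length w) v) = q w)"
        by (rule sum_of_bool_at) (simp_all add: True len)
      \<comment> \<open>A path never enters the source, so only the empty word sees a difference
        between leaving and entering; this is the unit supply.\<close>
      have into: "(\<Sum>i<n. of_bool (q (take (Suc i) v) = q w) :: real)
          = of_bool (w \<noteq> [] \<and> q (take (length w) v) = q w)"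
      proof (cases w rule: rev_cases)
        case Nil
        have "q (take (Suc i) v) \<noteq> q w" if "i < n" for i using len[of "Suc i" w] that Nil by auto
        then show ?thesis using Nil by simp
      next
        case (snoc u b)
        have "(\<Sum>i<n. of_bool (q (take (Suc i) v) = q w) :: real)
            = of_bool (q (take (Suc (length u)) v) = q w)"
        proof (rule sum_of_bool_at)
          show "i = length u" if "i < n" "q (take (Suc i) v) = q w" for i
            using len[OF that(2)] that(1) snoc by simp
        qed (use True snoc in simp)
        then show ?thesis using snoc by simp
      qed
      have "(\<Sum>i<n. coeff w (q (take i v), v ! i))
          = (\<Sum>i<n. of_bool (q (take i v) = q w)) - (\<Sum>i<n. of_bool (q (take (Suc i) v) = q w))"
        using True by (simp add: coeff_def step sum_subtractf)
      then show ?thesis unfolding out into by auto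
    next
      case False
      then have "length w = n" using w by simp
      \<comment> \<open>Level \<open>n\<close> is entered only by the last step, and there at
        \<open>q v\<close>, which is not rejecting.\<close>
      have "coeff w (q (take i v), v ! i) = 0" if "i < n" for i
        using False that v(2) len[of "Suc i" w] v(1) \<open>length w = n\<close>
        by (auto simp: coeff_def step)
      then show ?thesis using \<open>length w = n\<close> n_pos by auto
    qed
    finally show ?thesis .
  qed
  moreover have "0 \<le> path_flow v j" for j
    unfolding path_flow_def by (intro sum_nonneg) simp
  ultimately show ?thesis by (simp add: flow_def)
qed

lemma label_path_flow:
  assumes "length v = n"
  shows "(\<Sum>j\<in>arcs. path_flow v j *\<^sub>R label j) = word_vector v"
  unfolding sum_path_flow[OF assms] word_vector_def
  using assms by (intro sum.cong) (auto simp: label_def lev_q)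

section \<open>Decomposition of a flow by a random walk\<close>

definition throughput :: "('s \<times> bool \<Rightarrow> real) \<Rightarrow> 's \<Rightarrow> real" where
  "throughput y s = (\<Sum>b\<in>UNIV. y (s, b))"

text \<open>A flow is decomposed by a random walk that leaves each state along an arc with probability
  proportional to the flow on it. At states without throughput the quotient is the junk value
  \<open>0 / 0 = 0\<close>, which is harmless since such states are reached with probability \<open>0\<close>.\<close>

definition walk_prob :: "('s \<times> bool \<Rightarrow> real) \<Rightarrow> bool list \<Rightarrow> real" where
  "walk_prob y w = (\<Prod>i<length w. y (q (take i w), w ! i) / throughput y (q (take i w)))"

lemma walk_prob_snoc:
  "walk_prob y (w @ [b]) = walk_prob y w * (y (q w, b) / throughput y (q w))"
  by (simp add: walk_prob_def nth_append)

context
  fixes y assumes y: "flow y"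
begin

lemma flow_nonneg: "length w < n \<Longrightarrow> 0 \<le> y (q w, b)"
  using y by (auto simp: flow_def arcs_def)

lemma throughput_nonneg: "length w < n \<Longrightarrow> 0 \<le> throughput y (q w)"
  by (simp add: throughput_def sum_nonneg flow_nonneg)

lemma throughput_eq_0: "length w < n \<Longrightarrow> throughput y (q w) = 0 \<Longrightarrow> y (q w, b) = 0"
  unfolding throughput_def
  by (subst (asm) sum_nonneg_eq_0_iff) (auto simp: flow_nonneg)

lemma walk_prob_nonneg: "length w \<le> n \<Longrightarrow> 0 \<le> walk_prob y w"
  unfolding walk_prob_def
  by (intro prod_nonneg) (auto intro!: divide_nonneg_nonneg flow_nonneg throughput_nonneg)

lemma throughput_eq_sum_arcs:
  assumes "length w < n"
  shows "throughput y (q w) = (\<Sum>(s, b)\<in>arcs. of_bool (s = q w) * y (s, b))"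
proof -
  have "(\<Sum>(s, b)\<in>arcs. of_bool (s = q w) * y (s, b)) = (\<Sum>(s, b)\<in>{q w} \<times> UNIV. of_bool (s = q w) * y (s, b))"
    by (rule sum.mono_neutral_right) (use assms finite_arcs in \<open>auto simp: arcs_def\<close>)
  also have "\<dots> = throughput y (q w)"
    by (simp add: throughput_def flip: sum.cartesian_product)
  finally show ?thesis by simp
qed

text \<open>Heads of arcs have positive level, so nothing flows into the source and its equation
  says that the outflow is 1.\<close>

lemma throughput_source: "throughput y (q []) = 1"
proof -
  have "(\<Sum>j\<in>arcs. coeff [] j * y j) = 1" using y by (auto simp: flow_def)
  moreover have "(\<Sum>j\<in>arcs. coeff [] j * y j) = (\<Sum>(s, b)\<in>arcs. of_bool (s = q []) * y (s, b))"
  proof (rule sum.cong[OF refl], clarify)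
    fix s b assume "(s, b) \<in> arcs"
    then have "lev (\<delta> s b) \<noteq> lev (q [])" by (auto simp: arcs_def lev_\<delta> lev_q)
    then have "\<delta> s b \<noteq> q []" by auto
    then show "coeff [] (s, b) * y (s, b) = of_bool (s = q []) * y (s, b)"
      using n_pos by (simp add: coeff_def)
  qed
  ultimately show ?thesis using throughput_eq_sum_arcs[of "[]"] n_pos by simp
qed

definition inflow :: "'s \<Rightarrow> real" where
  "inflow t = (\<Sum>(s, b)\<in>arcs. of_bool (\<delta> s b = t) * y (s, b))"

lemma inflow_eq_throughput:
  assumes "length w < n" "w \<noteq> []"
  shows "inflow (q w) = throughput y (q w)"
proof -
  have "(\<Sum>j\<in>arcs. coeff w j * y j) = 0" using y assms by (auto simp: flow_def)
  moreover have "(\<Sum>j\<in>arcs. coeff w j * y j)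
      = (\<Sum>(s, b)\<in>arcs. of_bool (s = q w) * y (s, b)) - inflow (q w)"
    unfolding inflow_def sum_subtractf[symmetric]
    by (rule sum.cong) (use assms in \<open>auto simp: coeff_def left_diff_distrib\<close>)
  ultimately show ?thesis using throughput_eq_sum_arcs[of w] assms by simp
qed

lemma inflow_rejecting:
  assumes "length w = n" "q w \<notin> acc"
  shows "inflow (q w) = 0"
proof -
  have "(\<Sum>j\<in>arcs. coeff w j * y j) = 0" using y assms n_pos by (auto simp: flow_def)
  moreover have "(\<Sum>j\<in>arcs. coeff w j * y j) = inflow (q w)"
    unfolding inflow_def
    by (rule sum.cong) (use assms in \<open>auto simp: coeff_def\<close>)
  ultimately show ?thesis by simp
qed

lemma inflow_eq_level:
  assumes "i < n" "length w = Suc i"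
  shows "inflow (q w) = (\<Sum>(s, b)\<in>level_arcs i. of_bool (\<delta> s b = q w) * y (s, b))"
  unfolding inflow_def
proof (rule sum_arcs_level[OF assms(1)], clarify)
  fix s b assume s: "(s, b) \<in> arcs" and i: "lev (fst (s, b)) \<noteq> i"
  then have "lev (\<delta> s b) \<noteq> lev (q w)" using assms by (auto simp: arcs_def lev_\<delta> lev_q)
  then have "\<delta> s b \<noteq> q w" by auto
  then show "of_bool (\<delta> s b = q w) * y (s, b) = 0" by simp
qed

text \<open>The probability that the walk is in state \<open>s\<close> after \<open>i\<close>
  letters.\<close>

definition class_prob :: "nat \<Rightarrow> 's \<Rightarrow> real" where
  "class_prob i s = (\<Sum>w\<in>{w \<in> words i. q w = s}. walk_prob y w)"

text \<open>If each state of level \<open>i\<close> is visited with probability equal to its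
  throughput, then each arc leaving it is used with probability equal to its flow. The function
  \<open>F\<close> is later the indicator of a head, to advance the induction on levels, and
  \<open>label\<close>, to compute the mean vector.\<close>

lemma sum_walk_prob_arcs:
  fixes F :: "'s \<times> bool \<Rightarrow> 'b::real_vector"
  assumes i: "i < n" and cp: "\<And>w. length w = i \<Longrightarrow> class_prob i (q w) = throughput y (q w)"
  shows "(\<Sum>w\<in>words i. \<Sum>b\<in>UNIV. walk_prob y (w @ [b]) *\<^sub>R F (q w, b))
       = (\<Sum>j\<in>level_arcs i. y j *\<^sub>R F j)"
proof -
  have "(\<Sum>w\<in>words i. \<Sum>b\<in>UNIV. walk_prob y (w @ [b]) *\<^sub>R F (q w, b))
      = (\<Sum>s\<in>q ` words i. \<Sum>w\<in>{w \<in> words i. q w = s}. \<Sum>b\<in>UNIV. walk_prob y (w @ [b]) *\<^sub>R F (q w, b))"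
    by (rule sum.image_gen[OF finite_words])
  also have "\<dots> = (\<Sum>s\<in>q ` words i. \<Sum>b\<in>UNIV. y (s, b) *\<^sub>R F (s, b))"
  proof (rule sum.cong[OF refl])
    fix s assume "s \<in> q ` words i"
    then obtain u where u: "length u = i" "s = q u" by auto
    have "(\<Sum>w\<in>{w \<in> words i. q w = s}. \<Sum>b\<in>UNIV. walk_prob y (w @ [b]) *\<^sub>R F (q w, b))
        = (\<Sum>w\<in>{w \<in> words i. q w = s}. \<Sum>b\<in>UNIV.
             walk_prob y w *\<^sub>R ((y (s, b) / throughput y s) *\<^sub>R F (s, b)))"
      by (intro sum.cong refl) (auto simp: walk_prob_snoc)
    also have "\<dots> = class_prob i s *\<^sub>R (\<Sum>b\<in>UNIV. (y (s, b) / throughput y s) *\<^sub>R F (s, b))"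
      unfolding class_prob_def scaleR_sum_left unfolding scaleR_sum_right by (rule refl)
    \<comment> \<open>Without throughput, all arcs leaving \<open>s\<close> carry zero flow, so both
      sides vanish.\<close>
    also have "\<dots> = (\<Sum>b\<in>UNIV. y (s, b) *\<^sub>R F (s, b))"
      unfolding scaleR_sum_right
      using u i throughput_eq_0[of u] by (intro sum.cong) (auto simp: cp)
    finally show "(\<Sum>w\<in>{w \<in> words i. q w = s}. \<Sum>b\<in>UNIV. walk_prob y (w @ [b]) *\<^sub>R F (q w, b))
        = (\<Sum>b\<in>UNIV. y (s, b) *\<^sub>R F (s, b))" .
  qed
  also have "\<dots> = (\<Sum>j\<in>level_arcs i. y j *\<^sub>R F j)"
    unfolding level_arcs_def by (simp add: sum.cartesian_product case_prod_unfold)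
  finally show ?thesis .
qed

lemma class_prob_Suc:
  assumes i: "i < n" and cp: "\<And>w. length w = i \<Longrightarrow> class_prob i (q w) = throughput y (q w)"
    and u: "length u = Suc i"
  shows "class_prob (Suc i) (q u) = inflow (q u)"
proof -
  have "class_prob (Suc i) (q u) = (\<Sum>w\<in>words (Suc i). walk_prob y w * of_bool (q w = q u))"
    unfolding class_prob_def
    by (rule sum.mono_neutral_cong_left) (use finite_words in auto)
  also have "\<dots> = (\<Sum>w\<in>words i. \<Sum>b\<in>UNIV. walk_prob y (w @ [b]) * of_bool (\<delta> (q w) b = q u))"
    unfolding sum_words_Suc using i by (intro sum.cong refl) (auto simp: q_snoc)
  also have "\<dots> = (\<Sum>j\<in>level_arcs i. y j * of_bool (\<delta> (fst j) (snd j) = q u))"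
    using sum_walk_prob_arcs[OF i cp, of "\<lambda>j. of_bool (\<delta> (fst j) (snd j) = q u) :: real"] by simp
  also have "\<dots> = inflow (q u)"
    unfolding inflow_eq_level[OF i u] by (intro sum.cong) auto
  finally show ?thesis .
qed

text \<open>The source has probability and throughput 1. One step of the walk turns throughput into
  inflow at the next level, and flow conservation turns inflow back into throughput.\<close>

lemma class_prob_eq_throughput:
  "i < n \<Longrightarrow> length w = i \<Longrightarrow> class_prob i (q w) = throughput y (q w)"
proof (induction i arbitrary: w)
  case 0
  have "{w. w = [] \<and> q w = q []} = {[]}" by auto
  then show ?case using 0 by (simp add: class_prob_def throughput_source walk_prob_def)
next
  case (Suc i)
  have "class_prob (Suc i) (q w) = inflow (q w)"
    using Suc by (intro class_prob_Suc) auto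
  also have "\<dots> = throughput y (q w)"
    using Suc.prems by (intro inflow_eq_throughput) auto
  finally show ?case .
qed

lemma walk_prob_le_class_prob:
  assumes "length w \<le> n"
  shows "walk_prob y w \<le> class_prob (length w) (q w)"
  unfolding class_prob_def
  by (rule member_le_sum) (use assms finite_words in \<open>auto intro: walk_prob_nonneg\<close>)

lemma walk_prob_split:
  assumes "length w < n"
  shows "(\<Sum>b\<in>UNIV. walk_prob y (w @ [b])) = walk_prob y w"
proof -
  have "(\<Sum>b\<in>UNIV. walk_prob y (w @ [b])) = walk_prob y w * (throughput y (q w) / throughput y (q w))"
    by (simp only: walk_prob_snoc throughput_def sum_divide_distrib sum_distrib_left)
  \<comment> \<open>Here the quotient is 0 instead of 1. The identity survives because the
    probability of \<open>w\<close> is at most that of its state, which is the throughput 0.\<close>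
  moreover have "walk_prob y w = 0" if "throughput y (q w) = 0"
    using walk_prob_le_class_prob[of w] walk_prob_nonneg[of w] class_prob_eq_throughput[of _ w]
      assms that by simp
  ultimately show ?thesis by (cases "throughput y (q w) = 0") auto
qed

lemma walk_prob_total: "i \<le> n \<Longrightarrow> (\<Sum>w\<in>words i. walk_prob y w) = 1"
proof (induction i)
  case 0
  then show ?case by (simp add: walk_prob_def)
next
  case (Suc i)
  then show ?case by (simp add: sum_words_Suc walk_prob_split)
qed

text \<open>The last level has no outgoing arcs, so the visiting probability is compared with the
  inflow, which the final equations force to be 0 at rejecting states.\<close>

lemma walk_prob_rejecting:
  assumes w: "length w = n" "q w \<notin> acc"
  shows "walk_prob y w = 0"
proof -
  obtain i where i: "n = Suc i" using n_pos by (cases n) auto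
  have "class_prob (Suc i) (q w) = inflow (q w)"
    using w i by (intro class_prob_Suc class_prob_eq_throughput) auto
  also have "\<dots> = 0" using w by (rule inflow_rejecting)
  finally have "class_prob n (q w) = 0" by (simp add: i)
  then show ?thesis
    using walk_prob_le_class_prob[of w] walk_prob_nonneg[of w] w by simp
qed

text \<open>Linearity of expectation: each letter adds the expected label of the arc used at its
  level.\<close>

lemma walk_prob_mean:
  "i \<le> n \<Longrightarrow> (\<Sum>w\<in>words i. walk_prob y w *\<^sub>R word_vector w)
     = (\<Sum>k<i. \<Sum>j\<in>level_arcs k. y j *\<^sub>R label j)"
proof (induction i)
  case 0
  then show ?case by (simp add: word_vector_def)
next
  case (Suc i)
  have "(\<Sum>w\<in>words (Suc i). walk_prob y w *\<^sub>R word_vector w)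
      = (\<Sum>w\<in>words i. \<Sum>b\<in>UNIV. walk_prob y (w @ [b]) *\<^sub>R word_vector w
           + walk_prob y (w @ [b]) *\<^sub>R label (q w, b))"
    unfolding sum_words_Suc
    by (intro sum.cong refl) (auto simp: word_vector_snoc label_def lev_q scaleR_add_right)
  also have "\<dots> = (\<Sum>w\<in>words i. walk_prob y w *\<^sub>R word_vector w)
      + (\<Sum>w\<in>words i. \<Sum>b\<in>UNIV. walk_prob y (w @ [b]) *\<^sub>R label (q w, b))"
    using Suc.prems
    by (simp add: sum.distrib walk_prob_split flip: scaleR_sum_left)
  also have "\<dots> = (\<Sum>k<Suc i. \<Sum>j\<in>level_arcs k. y j *\<^sub>R label j)"
    using Suc sum_walk_prob_arcs[of i label] class_prob_eq_throughput by simp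
  finally show ?case .
qed

text \<open>The projected flow is the mean vector of the walk, and the walk ends in
  \<open>acc\<close> with probability 1.\<close>

lemma flow_in_hull:
  "(\<Sum>j\<in>arcs. y j *\<^sub>R label j) \<in> convex hull (word_vector ` {w \<in> words n. q w \<in> acc})"
proof -
  let ?S = "{w \<in> words n. q w \<in> acc}"
  have "(\<Sum>j\<in>arcs. y j *\<^sub>R label j) = (\<Sum>w\<in>words n. walk_prob y w *\<^sub>R word_vector w)"
    by (simp add: walk_prob_mean sum_arcs_levels)
  also have "\<dots> = (\<Sum>w\<in>?S. walk_prob y w *\<^sub>R word_vector w)"
    by (rule sum.mono_neutral_right) (use finite_words walk_prob_rejecting in auto)
  also have "\<dots> \<in> convex hull (word_vector ` ?S)"
  proof (rule convex_sum)
    have "(\<Sum>w\<in>?S. walk_prob y w) = (\<Sum>w\<in>words n. walk_prob y w)"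
      by (rule sum.mono_neutral_left) (use finite_words walk_prob_rejecting in auto)
    then show "(\<Sum>w\<in>?S. walk_prob y w) = 1" by (simp add: walk_prob_total)
  qed (auto simp: finite_words walk_prob_nonneg hull_inc)
  finally show ?thesis .
qed

end

text \<open>The projection of the flows is convex and contains the vectors of accepted words; the
  random walk gives the other inclusion. The factor 2 counts the arcs leaving a state.\<close>

lemma has_extended_formulation:
  "has_extended_formulation (convex hull (word_vector ` {w \<in> words n. q w \<in> acc}))
     (2 * card (q ` {w. length w < n}))"
proof -
  define P where "P = {\<Sum>j\<in>arcs. y j *\<^sub>R label j |y. (\<forall>j\<in>arcs. 0 \<le> y j) \<and>
    (\<forall>w\<in>{w. length w \<le> n}. (\<Sum>j\<in>arcs. coeff w j * y j) = of_bool (w = []))}"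
  have P_flow: "P = {\<Sum>j\<in>arcs. y j *\<^sub>R label j |y. flow y}"
    by (simp add: P_def flow_def)
  have "convex hull (word_vector ` {w \<in> words n. q w \<in> acc}) = P"
  proof
    have "convex P" unfolding P_def by (rule convex_nonneg_system)
    moreover have "word_vector v \<in> P" if "length v = n" "q v \<in> acc" for v
      unfolding P_flow using flow_path_flow[OF that] label_path_flow[of v] that by force
    ultimately show "convex hull (word_vector ` {w \<in> words n. q w \<in> acc}) \<subseteq> P"
      by (intro hull_minimal) auto
    show "P \<subseteq> convex hull (word_vector ` {w \<in> words n. q w \<in> acc})"
      unfolding P_flow using flow_in_hull by blast
  qed
  moreover have "has_extended_formulation P (card arcs)"
    unfolding P_def
    by (rule has_extended_formulation_nonneg_system[OF finite_arcs finite_words_le])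
  moreover have "card arcs = 2 * card (q ` {w. length w < n})"
    by (simp add: arcs_def card_cartesian_product)
  ultimately show ?thesis by simp
qed

end

section \<open>Forbidden vertices of the cube\<close>

context
  fixes L :: "bool list set"
begin

text \<open>The state of a word is its length together with the word itself as long as it is a prefix of
  a forbidden word. All other words of the same length share one state, which is what makes the
  number of states linear in \<open>n\<close>.\<close>

definition prefix_state :: "bool list \<Rightarrow> nat \<times> bool list option" where
  "prefix_state w = (length w, if \<exists>x\<in>L. take (length w) x = w then Some w else None)"

definition prefix_step :: "nat \<times> bool list option \<Rightarrow> bool \<Rightarrow> nat \<times> bool list option" where
  "prefix_step s b = (case s of (i, Some w) \<Rightarrow> prefix_state (w @ [b]) | (i, None) \<Rightarrow> (Suc i, None))"

text \<open>Prefixes of prefixes of forbidden words are again such prefixes, so a word that has left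
  the tree never returns and \<open>None\<close> is absorbing.\<close>

lemma branching_program_prefix_state:
  "0 < n \<Longrightarrow> branching_program n prefix_state fst prefix_step"
proof
  fix w b
  have "\<exists>x\<in>L. take (length w) x = w" if "\<exists>x\<in>L. take (length (w @ [b])) x = w @ [b]"
  proof -
    from that obtain x where x: "x \<in> L" "take (Suc (length w)) x = w @ [b]" by auto
    have "take (length w) x = take (length w) (take (Suc (length w)) x)" by (simp add: min_def)
    also have "\<dots> = w" using x by simp
    finally show ?thesis using x(1) by blast
  qed
  then show "prefix_state (w @ [b]) = prefix_step (prefix_state w) b"
    by (auto simp: prefix_step_def prefix_state_def)
qed (auto simp: prefix_state_def)

text \<open>Each level has one state for having left the tree and at most one prefix per forbidden
  word.\<close>

lemma card_prefix_states:
  assumes "finite L"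
  shows "card (prefix_state ` {w. length w < n}) \<le> n + n * card L"
proof -
  let ?S = "{..<n} \<times> {None} \<union> (\<lambda>(i, x). (i, Some (take i x))) ` ({..<n} \<times> L)"
  have "prefix_state w \<in> ?S" if "length w < n" for w
  proof (cases "\<exists>x\<in>L. take (length w) x = w")
    case True
    then obtain x where "x \<in> L" "take (length w) x = w" by blast
    then have "prefix_state w = (\<lambda>(i, x). (i, Some (take i x))) (length w, x)"
      by (auto simp: prefix_state_def)
    then show ?thesis using that \<open>x \<in> L\<close> by blast
  next
    case False
    then show ?thesis using that by (simp add: prefix_state_def)
  qed
  then have "prefix_state ` {w. length w < n} \<subseteq> ?S" by blast
  then have "card (prefix_state ` {w. length w < n}) \<le> card ?S"
    by (rule card_mono[rotated]) (use assms in simp)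
  also have "\<dots> \<le> card ({..<n} \<times> {None :: bool list option}) + card ({..<n} \<times> L)"
    by (rule order.trans[OF card_Un_le]) (intro add_mono order.refl card_image_le; use assms in simp)
  finally show ?thesis by (simp add: card_cartesian_product)
qed

text \<open>At full length, being a prefix of a forbidden word means being that word.\<close>

lemma prefix_state_accepts:
  assumes "L \<subseteq> {w. length w = n}" "length w = n"
  shows "snd (prefix_state w) = None \<longleftrightarrow> w \<notin> L"
  using assms by (auto simp: prefix_state_def subset_iff)

end

lemma xc_forb_cube_le:
  assumes n: "0 < n" and X: "X \<noteq> {}" "X \<subseteq> binary_vectors n"
  shows "xc (forb (cube n) X) \<le> 4 * n * card X"
proof -
  define L where "L = {w. length w = n \<and> word_vector w \<in> X}"
  have L_img: "word_vector ` L = X"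
    using X(2) unfolding word_vector_image[symmetric] L_def by auto
  have inj: "inj_on word_vector L"
    by (rule inj_on_subset[OF inj_on_word_vector[of n]]) (auto simp: L_def)
  have finL: "finite L"
    using finite_lists_length_eq[of "UNIV :: bool set" n] by (simp add: L_def)
  have card: "card L = card X" using card_image[OF inj] by (simp add: L_img)
  have pos: "0 < card X" using X(1) finL L_img by (auto simp: card_gt_0_iff)
  let ?q = "prefix_state L"
  have "{w \<in> {w. length w = n}. ?q w \<in> {s. snd s = None}} = {w. length w = n \<and> w \<notin> L}"
    using prefix_state_accepts[of L n] by (auto simp: L_def)
  moreover have "word_vector ` {w. length w = n \<and> w \<notin> L} = binary_vectors n - X"
    unfolding word_vector_image[symmetric] by (auto simp: L_def)
  ultimately have "has_extended_formulation (forb (cube n) X) (2 * card (?q ` {w. length w < n}))"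
    using branching_program.has_extended_formulation[OF branching_program_prefix_state[OF n, of L],
      of "{s. snd s = None}"]
    by (simp add: forb_def vert_cube)
  then have "xc (forb (cube n) X) \<le> 2 * card (?q ` {w. length w < n})"
    unfolding xc_def by (rule Least_le)
  also have "\<dots> \<le> 2 * (n + n * card X)"
    using card_prefix_states[OF finL, of n] card by simp
  \<comment> \<open>As \<open>X\<close> is nonempty, \<open>n \<le> n * card X\<close> absorbs the
    \<open>n\<close> states outside the tree.\<close>
  also have "\<dots> \<le> 4 * n * card X"
    using pos by (cases "card X") auto
  finally show ?thesis .
qed

theorem theorem12:
  shows "\<exists>C::real. \<forall>n\<ge>1. \<forall>X. X \<noteq> {} \<and> X \<subseteq> binary_vectors n \<longrightarrow>
           real (xc (forb (cube n) X)) \<le> C * real n * real (card X)"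
proof (intro exI[of _ 4] allI impI)
  fix n :: nat and X
  assume "1 \<le> n" "X \<noteq> {} \<and> X \<subseteq> binary_vectors n"
  then have "xc (forb (cube n) X) \<le> 4 * n * card X" by (intro xc_forb_cube_le) auto
  then have "real (xc (forb (cube n) X)) \<le> real (4 * n * card X)" by (rule of_nat_mono)
  then show "real (xc (forb (cube n) X)) \<le> 4 * real n * real (card X)" by simp
qed

end
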